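(* Let $f:\mathbb R^n\to\mathbb R$ and $g:\mathbb R^m\to\mathbb R$ be convex and continuously differentiable, let $K\in\mathbb R^{m\times n}$, and assume that the saddle point set $\mathcal S$ of $\mathcal L(x,y)=f(x)+\langle Kx,y\rangle-g(y)$ is nonempty. Let $\alpha\ge 3$, $\theta\in\left[\frac1{\alpha-1},\frac12\right]$, $t_0>0$, and let $z(t)=(x(t),y(t))$, $t\ge t_0$, be a trajectory (solution on $[t_0,+\infty)$) of $$\begin{cases}\ddot x(t)+\dfrac{\alpha}{t}\dot x(t)+\nabla f(x(t))+K^\top\bigl(y(t)+\theta t\,\dot y(t)\bigr)=0,\\[1ex] \ddot y(t)+\dfrac{\alpha}{t}\dot y(t)+\nabla g(y(t))-K\bigl(x(t)+\theta t\,\dot x(t)\bigr)=0.\end{cases}$$ Then there exists $(x^*,y^* )\in\mathcal S$ such that $(x(t),y(t))\to(x^*,y^* )$ as $t\to+\infty$. Assume further that $\alpha>3$ and $\theta\in\left(\frac1{\alpha-1},\frac12\right)$. Then, with $(x^*,y^* )$ this limit, the following hold as $t\to+\infty$: (i) $\mathcal L(x(t),y^* )-\mathcal L(x^*,y(t))=o\left(\frac1{t^2}\right)$ and $\|(\dot x(t),\dot y(t))\|=o\left(\frac1t\right)$. (ii) If, in addition, $\nabla f$ and $\nabla g$ are Lipschitz continuous with constants $L_f>0$ and $L_g>0$, respectively, then $$\left\|\begin{pmatrix}\nabla f(x(t))+K^\top y(t)\\ \nabla g(y(t))-Kx(t)\end{pmatrix}\right\|=o\left(\frac1t\right).$$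
   Context: A point $(x^*,y^* )\in\mathbb R^n\times\mathbb R^m$ is a saddle point of $\mathcal L$ if $\mathcal L(x^*,y)\le\mathcal L(x^*,y^* )\le\mathcal L(x,y^* )$ for all $(x,y)\in\mathbb R^n\times\mathbb R^m$; $\mathcal S$ denotes the set of all saddle points. Norms and inner products are Euclidean. A trajectory is a twice continuously differentiable function $z=(x,y):[t_0,+\infty)\to\mathbb R^n\times\mathbb R^m$ satisfying the system for all $t\ge t_0$. *)

theory Defs
  imports "HOL-Analysis.Analysis" "HOL-Library.Landau_Symbols"
begin

definition lagrangian ::
  "(real^'n \<Rightarrow> real) \<Rightarrow> (real^'m \<Rightarrow> real) \<Rightarrow> real^'n^'m \<Rightarrow> real^'n \<Rightarrow> real^'m \<Rightarrow> real"
  where "lagrangian f g K x y = f x + (K *v x) \<bullet> y - g y"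

definition saddle_points :: "('a \<Rightarrow> 'b \<Rightarrow> real) \<Rightarrow> ('a \<times> 'b) set"
  where "saddle_points L =
    {(xs, ys). \<forall>x y. L xs y \<le> L xs ys \<and> L xs ys \<le> L x ys}"

definition C1_with_gradient :: "('a::real_inner \<Rightarrow> real) \<Rightarrow> ('a \<Rightarrow> 'a) \<Rightarrow> bool"
  where "C1_with_gradient f f' \<longleftrightarrow> (\<forall>x. GDERIV f x :> f' x) \<and> continuous_on UNIV f'"

(* Derivatives are taken within the half-line, hence one-sided at t0; the values of the
   functions to the left of t0 are irrelevant. *)
definition C2_with_derivs ::
  "real \<Rightarrow> (real \<Rightarrow> 'a::real_normed_vector) \<Rightarrow> (real \<Rightarrow> 'a) \<Rightarrow> (real \<Rightarrow> 'a) \<Rightarrow> bool"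
  where "C2_with_derivs t0 x x' x'' \<longleftrightarrow>
    (\<forall>t\<ge>t0. (x has_vector_derivative x' t) (at t within {t0..})) \<and>
    (\<forall>t\<ge>t0. (x' has_vector_derivative x'' t) (at t within {t0..})) \<and>
    continuous_on {t0..} x''"

end

theory Submission
  imports Defs "HOL-Real_Asymp.Real_Asymp"
begin

text \<open>
  Write z = (x, y), \<phi>(x, y) = f x + g y, G = \<nabla>\<phi> and B (x, y) = (K^T y, - K x). Then B is linear
  and skew, the saddle points are the zeros of G + B, and the system becomes the single equation
  z'' + (\<alpha>/t) z' + G z + B (z + \<theta> t z') = 0. For a saddle point q the primal-dual gap at z is the
  Bregman distance D z q = \<phi> z - \<phi> q - G q \<bullet> (z - q), which is nonnegative by convexity.

  Put v = z - q + \<theta> t z' and \<xi> = \<theta> (\<alpha> - 1) - 1 \<ge> 0. Then v' = - \<xi> z' - \<theta> t (G z - G q + B v).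
  Because v is exactly the vector on which B acts, B drops out of the derivative of |v|^2, and the energy
  E q = |v|^2 / 2 + \<theta>^2 t^2 (D z q) + (\<xi> / 2) |z - q|^2 is nonincreasing (lemma energy_deriv_le).
  Hence v, z and t z' are bounded, D z q = O(1 / t^2), and G z \<rightarrow> G q.

  Convergence of z is an Opial argument that also covers \<alpha> = 3, \<theta> = 1/2, where the
  lower bound on the dissipation in energy_deriv_le is 0. It has two halves.

  \<^item> Cluster points are saddle points. The gap controls only G z, so the bilinear part has to be
    treated on its own: solving the formula for v' for B v shows that B (z - q), corrected by the
    vanishing term v / (\<theta> t)^2, satisfies r + \<theta> t r' \<rightarrow> 0. Since r is a weighted time average of
    r + \<theta> t r', r itself tends to 0 (lemma weighted_average_tendsto).

  \<^item> There is only one cluster point. For saddle points q1, q2 the functions D p q1 and D p q2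
    of p coincide, so E q1 - E q2 contains no values of \<phi>; it has the form (1 + \<xi>) w + \<theta> t w' with
    w = z \<bullet> (q2 - q1) + const. It converges, so w converges by the same averaging lemma, and inserting
    two cluster points q1, q2 gives |q2 - q1|^2 = 0.

  If \<xi> > 0 and \<theta> < 1/2, the energy dissipates at least a multiple of t k, where
  k = D z q + |z'|^2 / 2, while E q - \<theta>^2 t^2 k \<rightarrow> 0. A positive limit of t^2 k would make E q
  decrease like - ln t, which is impossible, so t^2 k \<rightarrow> 0. For Lipschitz gradients |G z - G q|^2 is
  bounded by a multiple of D z q, so t (G z - G q) \<rightarrow> 0, and repeating the averaging argument for t r gives
  t B (z - q) \<rightarrow> 0.
\<close>

section \<open>Averaging along a half-line\<close>

text \<open>
  The function w is the average of w + p t w' with weight t^(1/p - 1), since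
  (t^(1/p) w)' = (t^(1/p - 1) / p) (w + p t w'). L'Hospital's rule for t^(1/p) w / t^(1/p) turns this
  into convergence.
\<close>
lemma weighted_average_tendsto:
  fixes w w' :: "real \<Rightarrow> 'a::euclidean_space"
  assumes p: "p > 0"
    and deriv: "\<forall>\<^sub>F t in at_top. (w has_vector_derivative w' t) (at t)"
    and lim: "((\<lambda>t. w t + (p * t) *\<^sub>R w' t) \<longlongrightarrow> l) at_top"
  shows "(w \<longlongrightarrow> l) at_top"
proof (subst tendsto_componentwise_iff, intro ballI)
  fix b :: 'a assume b: "b \<in> Basis"
  have lim_b: "((\<lambda>t. w t \<bullet> b + p * t * (w' t \<bullet> b)) \<longlongrightarrow> l \<bullet> b) at_top"
    using tendsto_inner[OF lim tendsto_const[of b]] by (simp add: inner_add_left)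
  have "((\<lambda>t. t powr (1/p) * (w t \<bullet> b) / t powr (1/p)) \<longlongrightarrow> l \<bullet> b) at_top"
  proof (rule lhospital_at_top_at_top)
    show "LIM t at_top. t powr (1/p) :> at_top"
      using p by real_asymp
    show "\<forall>\<^sub>F t in at_top. t powr (1/p - 1) / p \<noteq> 0"
      using eventually_gt_at_top[of 0] by eventually_elim (use p in auto)
    show "\<forall>\<^sub>F t in at_top. ((\<lambda>t. t powr (1/p)) has_real_derivative t powr (1/p - 1) / p) (at t)"
      using eventually_gt_at_top[of 0]
      by eventually_elim (use p in \<open>auto intro!: derivative_eq_intros\<close>)
    show "\<forall>\<^sub>F t in at_top. ((\<lambda>t. t powr (1/p) * (w t \<bullet> b)) has_real_derivative
        t powr (1/p - 1) / p * (w t \<bullet> b + p * t * (w' t \<bullet> b))) (at t)"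
      using eventually_gt_at_top[of 0] deriv
    proof eventually_elim
      case (elim t)
      have "((\<lambda>t. w t \<bullet> b) has_real_derivative w' t \<bullet> b) (at t)"
        using bounded_linear.has_vector_derivative[OF bounded_linear_inner_left elim(2), of b]
        by (simp add: has_real_derivative_iff_has_vector_derivative)
      moreover have "t powr (1/p) = t * t powr ((1 - p) / p)"
        using p elim(1) by (simp add: diff_divide_distrib powr_diff)
      ultimately show ?case
        using p elim(1) by (auto intro!: derivative_eq_intros simp: field_simps)
    qed
    show "((\<lambda>t. t powr (1/p - 1) / p * (w t \<bullet> b + p * t * (w' t \<bullet> b)) / (t powr (1/p - 1) / p))
        \<longlongrightarrow> l \<bullet> b) at_top"
      using lim_b
    proof (rule Lim_transform_eventually)
      show "\<forall>\<^sub>F t in at_top. w t \<bullet> b + p * t * (w' t \<bullet> b) =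
          t powr (1/p - 1) / p * (w t \<bullet> b + p * t * (w' t \<bullet> b)) / (t powr (1/p - 1) / p)"
        using eventually_gt_at_top[of 0] by eventually_elim (use p in auto)
    qed
  qed
  then show "((\<lambda>t. w t \<bullet> b) \<longlongrightarrow> l \<bullet> b) at_top"
  proof (rule Lim_transform_eventually)
    show "\<forall>\<^sub>F t in at_top. t powr (1/p) * (w t \<bullet> b) / t powr (1/p) = w t \<bullet> b"
      using eventually_gt_at_top[of 0] by eventually_elim auto
  qed
qed

lemma norm_sq_deriv:
  fixes w :: "real \<Rightarrow> 'a::real_inner"
  assumes "(w has_vector_derivative w') (at t)"
  shows "((\<lambda>t. (norm (w t))\<^sup>2) has_real_derivative 2 * (w t \<bullet> w')) (at t)"
  unfolding power2_norm_eq_inner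
  using bounded_bilinear.has_vector_derivative[OF bounded_bilinear_inner assms assms]
  by (simp add: has_real_derivative_iff_has_vector_derivative inner_commute)

text \<open>
  The bounded counterpart: |w|^2 + p t (|w|^2)' = |w + p t w'|^2 - |p t w'|^2 \<le> M^2, so
  t^(1/p) (|w|^2 - M^2) is nonincreasing.
\<close>
lemma weighted_average_bounded:
  fixes w w' :: "real \<Rightarrow> 'a::real_inner"
  assumes p: "p > 0" and T: "T > 0"
    and deriv: "\<And>t. t \<ge> T \<Longrightarrow> (w has_vector_derivative w' t) (at t)"
    and bound: "\<And>t. t \<ge> T \<Longrightarrow> norm (w t + (p * t) *\<^sub>R w' t) \<le> M"
  obtains C where "\<And>t. t \<ge> T \<Longrightarrow> norm (w t) \<le> C"
proof -
  define m where "m = (\<lambda>t. (norm (w t))\<^sup>2)"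
  define \<Phi> where "\<Phi> = (\<lambda>t. t powr (1/p) * (m t - M\<^sup>2))"
  have \<Phi>_le: "\<Phi> t \<le> \<Phi> T" if "t \<ge> T" for t
  proof (rule DERIV_nonpos_imp_nonincreasing[OF that], intro exI conjI)
    fix s assume s: "T \<le> s" "s \<le> t"
    let ?v = "w s + (p * s) *\<^sub>R w' s"
    have dm: "(m has_real_derivative 2 * (w s \<bullet> w' s)) (at s)"
      unfolding m_def by (rule norm_sq_deriv[OF deriv[OF s(1)]])
    have "s powr (1/p) = s * s powr ((1 - p) / p)"
      using p T s by (simp add: diff_divide_distrib powr_diff)
    then show "(\<Phi> has_real_derivative
        s powr (1/p - 1) / p * (m s - M\<^sup>2 + p * s * (2 * (w s \<bullet> w' s)))) (at s)"
      unfolding \<Phi>_def using p T s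
      by (auto intro!: derivative_eq_intros dm simp: field_simps)
    have "(norm ?v)\<^sup>2 \<le> M\<^sup>2"
      by (intro power_mono bound s) auto
    moreover have "(norm ?v)\<^sup>2 = m s + p * s * (2 * (w s \<bullet> w' s)) + (norm ((p * s) *\<^sub>R w' s))\<^sup>2"
      unfolding m_def by (simp add: power2_norm_eq_inner algebra_simps inner_commute) (simp add: power2_eq_square)
    ultimately have "m s - M\<^sup>2 + p * s * (2 * (w s \<bullet> w' s)) \<le> 0"
      by (smt (verit) zero_le_power2)
    then show "s powr (1/p - 1) / p * (m s - M\<^sup>2 + p * s * (2 * (w s \<bullet> w' s))) \<le> 0"
      using p by (intro mult_nonneg_nonpos) auto
  qed
  have "m t \<le> M\<^sup>2 + \<bar>\<Phi> T\<bar> / T powr (1/p)" if t: "t \<ge> T" for t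
  proof -
    have pos: "0 < T powr (1/p)" "T powr (1/p) \<le> t powr (1/p)"
      using T t p by (auto intro: powr_mono2)
    have "m t - M\<^sup>2 = \<Phi> t / t powr (1/p)"
      using pos by (auto simp: \<Phi>_def)
    also have "\<dots> \<le> \<bar>\<Phi> T\<bar> / t powr (1/p)"
      using \<Phi>_le[OF t] pos by (intro divide_right_mono) auto
    also have "\<dots> \<le> \<bar>\<Phi> T\<bar> / T powr (1/p)"
      using pos by (intro divide_left_mono mult_pos_pos) auto
    finally show ?thesis by simp
  qed
  then have "norm (w t) \<le> sqrt (M\<^sup>2 + \<bar>\<Phi> T\<bar> / T powr (1/p))" if "t \<ge> T" for t
    using that real_le_rsqrt unfolding m_def by blast
  then show thesis by (rule that)
qed

lemma scaled_bounded_tendsto_0: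
  fixes w :: "real \<Rightarrow> 'a::real_normed_vector"
  assumes "(c \<longlongrightarrow> (0::real)) at_top" and "\<And>t. t \<ge> T \<Longrightarrow> norm (w t) \<le> M"
  shows "((\<lambda>t. c t *\<^sub>R w t) \<longlongrightarrow> 0) at_top"
proof (rule Lim_null_comparison)
  show "\<forall>\<^sub>F t in at_top. norm (c t *\<^sub>R w t) \<le> \<bar>c t\<bar> * M"
    using eventually_ge_at_top[of T]
    by eventually_elim (use assms(2) in \<open>auto intro: mult_left_mono\<close>)
  show "((\<lambda>t. \<bar>c t\<bar> * M) \<longlongrightarrow> 0) at_top"
    using tendsto_mult_left_zero[OF tendsto_rabs_zero[OF assms(1)]] .
qed

text \<open>
  Bolzano-Weierstrass in the form used twice below: to show that a continuous function of the orbit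
  converges because it takes the same value at all cluster points, and that the orbit converges because it
  has only one.
\<close>
lemma eventually_near_cluster_points:
  fixes w :: "real \<Rightarrow> 'a::heine_borel"
  assumes bdd: "bounded (w ` {T..})" and "open U"
    and cluster: "\<And>s l. filterlim s at_top sequentially \<Longrightarrow> (\<lambda>n. w (s n)) \<longlonglongrightarrow> l \<Longrightarrow> l \<in> U"
  shows "\<forall>\<^sub>F t in at_top. w t \<in> U"
proof (rule ccontr)
  assume "\<not> ?thesis"
  then have "\<exists>t\<ge>max T (real n). w t \<notin> U" for n :: nat
    unfolding eventually_at_top_linorder by blast
  then obtain s where s: "\<And>n. s n \<ge> max T (real n)" "\<And>n. w (s n) \<notin> U"
    by metis
  have "bounded (range (\<lambda>n. w (s n)))"
    by (rule bounded_subset[OF bdd]) (use s(1) in auto)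
  then obtain l r where r: "strict_mono r" "((\<lambda>n. w (s n)) \<circ> r) \<longlonglongrightarrow> l"
    using bounded_imp_convergent_subsequence by blast
  have "filterlim (\<lambda>n. s (r n)) at_top sequentially"
  proof (rule filterlim_at_top_mono)
    show "filterlim (\<lambda>n. real (r n)) at_top sequentially"
      using filterlim_compose[OF filterlim_real_sequentially filterlim_subseq[OF r(1)]] .
    show "\<forall>\<^sub>F n in sequentially. real (r n) \<le> s (r n)"
      using s(1) by (intro always_eventually) (metis max.bounded_iff)
  qed
  then have "l \<in> U"
    using cluster[of "\<lambda>n. s (r n)" l] r(2) by (simp add: o_def)
  moreover have "l \<in> - U"
  proof (rule closed_sequentially)
    show "closed (- U)" using \<open>open U\<close> by auto
    show "((\<lambda>n. w (s n)) \<circ> r) \<longlonglongrightarrow> l" by (fact r(2))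
  qed (use s(2) in auto)
  ultimately show False by simp
qed

lemma nonincreasing_bounded_below_tendsto:
  fixes E :: "real \<Rightarrow> real"
  assumes mono: "\<And>s t. T \<le> s \<Longrightarrow> s \<le> t \<Longrightarrow> E t \<le> E s"
    and bdd: "\<And>t. T \<le> t \<Longrightarrow> c \<le> E t"
  obtains l where "(E \<longlongrightarrow> l) at_top"
proof
  have bb: "bdd_below (E ` {T..})"
    using bdd by (intro bdd_belowI[of _ c]) auto
  show "(E \<longlongrightarrow> Inf (E ` {T..})) at_top"
  proof (rule order_tendstoI)
    fix a assume a: "a < Inf (E ` {T..})"
    show "\<forall>\<^sub>F t in at_top. a < E t"
      using eventually_ge_at_top[of T]
      by eventually_elim (use a cInf_lower[OF _ bb] in force)
  next
    fix a assume "Inf (E ` {T..}) < a"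
    then obtain s where s: "s \<ge> T" "E s < a"
      using cInf_lessD[of "E ` {T..}" a] by auto
    show "\<forall>\<^sub>F t in at_top. E t < a"
      using eventually_ge_at_top[of s]
      by eventually_elim (use s mono in force)
  qed
qed

section \<open>Bregman distances of convex functions\<close>

definition bregman :: "('a::real_inner \<Rightarrow> real) \<Rightarrow> ('a \<Rightarrow> 'a) \<Rightarrow> 'a \<Rightarrow> 'a \<Rightarrow> real"
  where "bregman \<phi> G p q = \<phi> p - \<phi> q - G q \<bullet> (p - q)"

lemma bregman_nonneg:
  assumes convex: "convex_on UNIV \<phi>" and grad: "GDERIV \<phi> q :> G q"
  shows "bregman \<phi> G p q \<ge> 0"
proof (rule ccontr)
  assume neg: "\<not> ?thesis"
  define \<psi> where "\<psi> = (\<lambda>u. \<phi> (q + u *\<^sub>R (p - q)) - u * (\<phi> p - \<phi> q))"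
  have "(\<phi> has_derivative (\<lambda>h. h \<bullet> G q)) (at (q + 0 *\<^sub>R (p - q)))"
    using grad by (simp add: gderiv_def)
  then have "((\<lambda>u. \<phi> (q + u *\<^sub>R (p - q))) has_derivative (\<lambda>u. (u *\<^sub>R (p - q)) \<bullet> G q)) (at (0::real))"
    by (rule has_derivative_compose[rotated]) (auto intro!: derivative_eq_intros)
  then have "((\<lambda>u. \<phi> (q + u *\<^sub>R (p - q))) has_real_derivative (p - q) \<bullet> G q) (at 0)"
    by (simp add: has_field_derivative_def mult_commute_abs)
  then have "(\<psi> has_real_derivative (p - q) \<bullet> G q - (\<phi> p - \<phi> q)) (at 0)"
    unfolding \<psi>_def by (auto intro!: derivative_eq_intros)
  moreover have "(p - q) \<bullet> G q - (\<phi> p - \<phi> q) > 0"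
    using neg by (simp add: bregman_def inner_commute)
  ultimately obtain d where d: "d > 0" "\<And>h. h > 0 \<Longrightarrow> h < d \<Longrightarrow> \<psi> 0 < \<psi> (0 + h)"
    using DERIV_pos_inc_right by blast
  define u where "u = min (d / 2) 1"
  have u: "0 < u" "u < d" "u \<le> 1"
    using d(1) by (auto simp: u_def)
  have "\<phi> ((1 - u) *\<^sub>R q + u *\<^sub>R p) \<le> (1 - u) * \<phi> q + u * \<phi> p"
    using convex u by (intro convex_onD[OF convex]) auto
  moreover have "(1 - u) *\<^sub>R q + u *\<^sub>R p = q + u *\<^sub>R (p - q)"
    by (simp add: algebra_simps)
  ultimately have "\<psi> u \<le> \<psi> 0"
    by (simp add: \<psi>_def algebra_simps)
  with d(2)[of u] u show False by simp
qed

lemma bregman_gderiv: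
  assumes "GDERIV \<phi> p :> G p"
  shows "GDERIV (\<lambda>p. bregman \<phi> G p q) p :> G p - G q"
  using assms unfolding gderiv_def bregman_def
  by (auto intro!: derivative_eq_intros simp: inner_diff_right inner_commute)

lemma bregman_le_inner:
  assumes "convex_on UNIV \<phi>" "\<And>p. GDERIV \<phi> p :> G p"
  shows "bregman \<phi> G p q \<le> (G p - G q) \<bullet> (p - q)"
  using bregman_nonneg[of \<phi> p G q] assms
  by (simp add: bregman_def algebra_simps)

lemma bregman_eq_0_imp_gradient_eq:
  assumes "convex_on UNIV \<phi>" "\<And>p. GDERIV \<phi> p :> G p" and "bregman \<phi> G p q = 0"
  shows "G p = G q"
proof -
  have "(\<lambda>h. h \<bullet> (G p - G q)) = (\<lambda>h. 0)"
  proof (rule has_derivative_local_min)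
    show "((\<lambda>p. bregman \<phi> G p q) has_derivative (\<lambda>h. h \<bullet> (G p - G q))) (at p)"
      using bregman_gderiv[of \<phi> p G q] assms(2) by (simp add: gderiv_def)
    show "\<forall>\<^sub>F y in at p. bregman \<phi> G p q \<le> bregman \<phi> G y q"
      using assms by (simp add: bregman_nonneg)
  qed
  then have "(G p - G q) \<bullet> (G p - G q) = 0" by metis
  then show ?thesis by simp
qed

text \<open>
  A form of cocoercivity with a nonoptimal constant: the Bregman distance is nonnegative after the
  gradient step from p to p - (G p - G q) / (2 L), and this step lowers it by at least
  |G p - G q|^2 / (4 L).
\<close>
lemma gradient_sq_le_bregman:
  assumes convex: "convex_on UNIV \<phi>" and grad: "\<And>p. GDERIV \<phi> p :> G p"
    and lip: "L-lipschitz_on UNIV G" and L: "L > 0"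
  shows "(norm (G p - G q))\<^sup>2 \<le> 4 * L * bregman \<phi> G p q"
proof -
  define d where "d = G p - G q"
  define r where "r = p - (1 / (2 * L)) *\<^sub>R d"
  have "bregman \<phi> G p q - bregman \<phi> G r q = bregman \<phi> G p r + (G r - G q) \<bullet> (p - r)"
    by (simp add: bregman_def algebra_simps)
  moreover have "bregman \<phi> G r q \<ge> 0" "bregman \<phi> G p r \<ge> 0"
    using convex grad by (auto simp: bregman_nonneg)
  ultimately have "bregman \<phi> G p q \<ge> (G r - G q) \<bullet> (p - r)"
    by linarith
  moreover have "(G p - G r) \<bullet> (p - r) \<le> norm (G p - G r) * norm (p - r)"
    by (rule norm_cauchy_schwarz)
  moreover have "\<dots> \<le> L * norm (p - r) * norm (p - r)"
    using lipschitz_onD[OF lip, of p r] by (intro mult_right_mono) (auto simp: dist_norm)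
  moreover have "(G r - G q) \<bullet> (p - r) = d \<bullet> (p - r) - (G p - G r) \<bullet> (p - r)"
    by (simp add: d_def inner_diff_left)
  ultimately have "bregman \<phi> G p q \<ge> d \<bullet> (p - r) - L * norm (p - r) * norm (p - r)"
    by linarith
  moreover have "d \<bullet> (p - r) = (norm d)\<^sup>2 / (2 * L)" "norm (p - r) = norm d / (2 * L)"
    using L by (auto simp: r_def power2_norm_eq_inner)
  ultimately have "bregman \<phi> G p q \<ge> (norm d)\<^sup>2 / (4 * L)"
    using L by (simp add: field_simps power2_eq_square)
  then show ?thesis
    using L by (simp add: d_def field_simps)
qed

lemma convex_C1_minimiser_iff:
  assumes convex: "convex_on UNIV h" and grad: "\<And>p. GDERIV h p :> h' p"
  shows "(\<forall>p. h q + c \<bullet> q \<le> h p + c \<bullet> p) \<longleftrightarrow> h' q + c = 0"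
proof
  assume min: "\<forall>p. h q + c \<bullet> q \<le> h p + c \<bullet> p"
  have "(\<lambda>v. v \<bullet> (h' q + c)) = (\<lambda>v. 0)"
  proof (rule has_derivative_local_min)
    show "((\<lambda>p. h p + c \<bullet> p) has_derivative (\<lambda>v. v \<bullet> (h' q + c))) (at q)"
      using grad[of q] unfolding gderiv_def
      by (auto intro!: derivative_eq_intros simp: inner_add_right inner_commute)
    show "\<forall>\<^sub>F p in at q. h q + c \<bullet> q \<le> h p + c \<bullet> p"
      using min by (intro always_eventually) blast
  qed
  then have "(h' q + c) \<bullet> (h' q + c) = 0" by metis
  then show "h' q + c = 0" by simp
next
  assume "h' q + c = 0"
  then have "c = - h' q" by (simp add: eq_neg_iff_add_eq_0 add.commute)
  then show "\<forall>p. h q + c \<bullet> q \<le> h p + c \<bullet> p"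
    using bregman_nonneg[where \<phi> = h and G = h' and q = q, OF convex grad] by (auto simp: bregman_def inner_diff_right algebra_simps)
qed

section \<open>The inertial flow of a gradient with a skew perturbation\<close>

text \<open>
  The field G + B is monotone, but in general not a gradient; the extrapolation by \<theta> t z' in the argument
  of B is what makes the rotation caused by B invisible to the energy.
\<close>
locale inertial_flow =
  fixes \<phi> :: "'a::euclidean_space \<Rightarrow> real" and G B :: "'a \<Rightarrow> 'a"
    and z z' z'' :: "real \<Rightarrow> 'a" and \<alpha> \<theta> T :: real
  assumes convex: "convex_on UNIV \<phi>"
    and gradient: "GDERIV \<phi> p :> G p"
    and continuous_gradient: "continuous_on UNIV G"
    and linear_B: "linear B"
    and skew: "B p \<bullet> p = 0"
    and \<theta>_pos: "\<theta> > 0" and \<theta>_ge: "\<theta> * (\<alpha> - 1) \<ge> 1" and \<theta>_le: "\<theta> \<le> 1/2"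
    and T_pos: "T > 0"
    and velocity: "t \<ge> T \<Longrightarrow> (z has_vector_derivative z' t) (at t)"
    and acceleration: "t \<ge> T \<Longrightarrow> (z' has_vector_derivative z'' t) (at t)"
    and flow: "t \<ge> T \<Longrightarrow>
      z'' t + (\<alpha> / t) *\<^sub>R z' t + G (z t) + B (z t + (\<theta> * t) *\<^sub>R z' t) = 0"
begin

abbreviation D :: "'a \<Rightarrow> 'a \<Rightarrow> real"
  where "D \<equiv> bregman \<phi> G"

definition equilibrium :: "'a \<Rightarrow> bool"
  where "equilibrium q \<longleftrightarrow> G q + B q = 0"

definition \<xi> :: real
  where "\<xi> = \<theta> * (\<alpha> - 1) - 1"

text \<open>
  The argument of B in the flow, relative to q.
\<close>
definition extrapolated :: "'a \<Rightarrow> real \<Rightarrow> 'a"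
  where "extrapolated q t = z t - q + (\<theta> * t) *\<^sub>R z' t"

definition energy :: "'a \<Rightarrow> real \<Rightarrow> real"
  where "energy q t = (norm (extrapolated q t))\<^sup>2 / 2 + \<theta>\<^sup>2 * t\<^sup>2 * D (z t) q
    + \<xi> / 2 * (norm (z t - q))\<^sup>2"

lemma \<xi>_nonneg: "\<xi> \<ge> 0"
  using \<theta>_ge by (simp add: \<xi>_def)

lemma D_nonneg: "D p q \<ge> 0"
  by (simp add: bregman_nonneg convex gradient)

lemma B_add: "B (p + q) = B p + B q"
  and B_diff: "B (p - q) = B p - B q"
  and B_scale: "B (c *\<^sub>R p) = c *\<^sub>R B p"
  using linear_B by (auto simp: linear_add linear_diff linear_scale)

lemma eventually_T: "\<forall>\<^sub>F t in at_top. t \<ge> T \<and> t > 0"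
  using eventually_ge_at_top[of T] by eventually_elim (use T_pos in auto)

lemma extrapolated_deriv:
  assumes q: "equilibrium q" and t: "t \<ge> T"
  shows "(extrapolated q has_vector_derivative
    - (\<xi> *\<^sub>R z' t) - (\<theta> * t) *\<^sub>R (G (z t) - G q + B (extrapolated q t))) (at t)"
proof -
  let ?W = "G (z t) - G q + B (extrapolated q t)"
  have "B (z t + (\<theta> * t) *\<^sub>R z' t) = B (extrapolated q t) + B q"
    by (simp add: extrapolated_def B_add B_diff)
  moreover have "B q = - G q"
    using q by (simp add: equilibrium_def eq_neg_iff_add_eq_0 add.commute)
  ultimately have flow': "z'' t + (\<alpha> / t) *\<^sub>R z' t + G (z t) + (B (extrapolated q t) - G q) = 0"
    using flow[OF t] by simp
  have "z'' t = (z'' t + (\<alpha> / t) *\<^sub>R z' t + G (z t) + (B (extrapolated q t) - G q))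
      - (\<alpha> / t) *\<^sub>R z' t - ?W"
    by simp
  then have "z'' t = - ((\<alpha> / t) *\<^sub>R z' t) - ?W"
    unfolding flow' by simp
  then have "(\<theta> * t) *\<^sub>R z'' t = - ((\<theta> * \<alpha>) *\<^sub>R z' t) - (\<theta> * t) *\<^sub>R ?W"
    using t T_pos by (simp add: scaleR_diff_right)
  then have eq: "z' t + (\<theta> *\<^sub>R z' t + (\<theta> * t) *\<^sub>R z'' t) = - (\<xi> *\<^sub>R z' t) - (\<theta> * t) *\<^sub>R ?W"
    by (simp add: \<xi>_def algebra_simps)
  have "(extrapolated q has_vector_derivative z' t + (\<theta> *\<^sub>R z' t + (\<theta> * t) *\<^sub>R z'' t)) (at t)"
    unfolding extrapolated_def
    by (auto intro!: derivative_eq_intros velocity acceleration t)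
  then show ?thesis unfolding eq .
qed

lemma D_along_deriv:
  assumes "t \<ge> T"
  shows "((\<lambda>t. D (z t) q) has_real_derivative (G (z t) - G q) \<bullet> z' t) (at t)"
proof -
  have "((\<lambda>p. D p q) has_derivative (\<lambda>h. h \<bullet> (G (z t) - G q))) (at (z t))"
    using bregman_gderiv[of \<phi> "z t" G q] gradient by (simp add: gderiv_def)
  then have "((\<lambda>t. D (z t) q) has_derivative (\<lambda>s. (s *\<^sub>R z' t) \<bullet> (G (z t) - G q))) (at t)"
    using velocity[OF assms] unfolding has_vector_derivative_def
    by (rule has_derivative_compose[rotated])
  then show ?thesis
    by (simp add: has_field_derivative_def mult_commute_abs inner_commute)
qed

lemma energy_deriv:
  assumes q: "equilibrium q" and t: "t \<ge> T"
  shows "(energy q has_real_derivative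
    2 * \<theta>\<^sup>2 * t * D (z t) q - \<theta> * t * ((G (z t) - G q) \<bullet> (z t - q))
    - \<xi> * \<theta> * t * (norm (z' t))\<^sup>2) (at t)"
proof -
  let ?m = "extrapolated q t" and ?W = "G (z t) - G q" and ?d = "z t - q"
  have "((\<lambda>t. z t - q) has_vector_derivative z' t) (at t)"
    using velocity[OF t] by (auto intro!: derivative_eq_intros)
  note norms = norm_sq_deriv[OF extrapolated_deriv[OF q t]] norm_sq_deriv[OF this]
  have combine: "((\<lambda>t. a t / 2 + \<theta>\<^sup>2 * t\<^sup>2 * b t + \<xi> / 2 * c t) has_real_derivative
      a' / 2 + \<theta>\<^sup>2 * (2 * t * b t + t\<^sup>2 * b') + \<xi> / 2 * c') (at t)"
    if "(a has_real_derivative a') (at t)" "(b has_real_derivative b') (at t)"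
      "(c has_real_derivative c') (at t)" for a b c a' b' c'
    using that by (auto intro!: derivative_eq_intros simp: algebra_simps)
  have raw: "(energy q has_real_derivative
      ?m \<bullet> (- (\<xi> *\<^sub>R z' t) - (\<theta> * t) *\<^sub>R (?W + B ?m))
      + \<theta>\<^sup>2 * (2 * t * D (z t) q + t\<^sup>2 * (?W \<bullet> z' t)) + \<xi> * (?d \<bullet> z' t)) (at t)"
    using combine[OF norms(1) D_along_deriv[OF t, of q] norms(2)]
    unfolding energy_def by simp
  have "?m \<bullet> B ?m = 0"
    using skew[of ?m] by (simp add: inner_commute)
  then have "?m \<bullet> (- (\<xi> *\<^sub>R z' t) - (\<theta> * t) *\<^sub>R (?W + B ?m))
      = - \<xi> * (?m \<bullet> z' t) - \<theta> * t * (?m \<bullet> ?W)"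
    by (simp add: inner_diff_right inner_add_right)
  also have "?m \<bullet> z' t = ?d \<bullet> z' t + \<theta> * t * (norm (z' t))\<^sup>2"
    by (simp add: extrapolated_def inner_add_left power2_norm_eq_inner)
  also have "?m \<bullet> ?W = ?W \<bullet> ?d + \<theta> * t * (?W \<bullet> z' t)"
    by (simp only: extrapolated_def inner_add_right inner_scaleR_right inner_commute[of _ ?W])
  finally have expand: "?m \<bullet> (- (\<xi> *\<^sub>R z' t) - (\<theta> * t) *\<^sub>R (?W + B ?m))
      = - \<xi> * (?d \<bullet> z' t + \<theta> * t * (norm (z' t))\<^sup>2)
        - \<theta> * t * (?W \<bullet> ?d + \<theta> * t * (?W \<bullet> z' t))" .
  show ?thesis
    by (rule DERIV_cong[OF raw[unfolded expand]]) (simp add: algebra_simps power2_eq_square)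
qed

text \<open>
  The gap contributes 2 \<theta>^2 t (D z q) through the growing weight t^2 and at most - \<theta> t (D z q) through
  convexity; \<theta> \<le> 1/2 makes the sum nonpositive.
\<close>
lemma energy_deriv_le:
  assumes q: "equilibrium q" and t: "t \<ge> T"
  obtains e where "(energy q has_real_derivative e) (at t)"
    and "e \<le> - \<theta> * (1 - 2 * \<theta>) * t * D (z t) q - \<xi> * \<theta> * t * (norm (z' t))\<^sup>2"
proof (rule that[OF energy_deriv[OF q t]])
  have "\<theta> * t * D (z t) q \<le> \<theta> * t * ((G (z t) - G q) \<bullet> (z t - q))"
    using \<theta>_pos t T_pos bregman_le_inner[of \<phi> G "z t" q] convex gradient
    by (intro mult_left_mono) auto
  then show "2 * \<theta>\<^sup>2 * t * D (z t) q - \<theta> * t * ((G (z t) - G q) \<bullet> (z t - q))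
    - \<xi> * \<theta> * t * (norm (z' t))\<^sup>2
    \<le> - \<theta> * (1 - 2 * \<theta>) * t * D (z t) q - \<xi> * \<theta> * t * (norm (z' t))\<^sup>2"
    by (simp add: algebra_simps power2_eq_square)
qed

lemma energy_nonincreasing:
  assumes q: "equilibrium q" and st: "T \<le> s" "s \<le> t"
  shows "energy q t \<le> energy q s"
proof (rule DERIV_nonpos_imp_nonincreasing[OF st(2)])
  fix r assume r: "s \<le> r" "r \<le> t"
  then have rT: "r \<ge> T" using st by simp
  obtain e where e: "(energy q has_real_derivative e) (at r)"
    "e \<le> - \<theta> * (1 - 2 * \<theta>) * r * D (z r) q - \<xi> * \<theta> * r * (norm (z' r))\<^sup>2"
    using energy_deriv_le[OF q rT] .
  have "0 \<le> \<theta> * (1 - 2 * \<theta>) * r * D (z r) q" "0 \<le> \<xi> * \<theta> * r * (norm (z' r))\<^sup>2"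
    using \<theta>_pos \<theta>_le \<xi>_nonneg rT T_pos D_nonneg[of "z r" q] by auto
  with e show "\<exists>y. (energy q has_real_derivative y) (at r) \<and> y \<le> 0"
    by force
qed

lemma energy_nonneg: "energy q t \<ge> 0"
  using \<xi>_nonneg D_nonneg by (simp add: energy_def)

lemma energy_tendsto:
  assumes "equilibrium q"
  obtains l where "(energy q \<longlongrightarrow> l) at_top"
  using nonincreasing_bounded_below_tendsto[of T "energy q" 0] energy_nonincreasing[OF assms]
    energy_nonneg by blast

lemma extrapolated_bounded:
  assumes q: "equilibrium q"
  obtains M where "\<And>t. t \<ge> T \<Longrightarrow> norm (extrapolated q t) \<le> M"
proof
  fix t assume t: "t \<ge> T"
  have "(norm (extrapolated q t))\<^sup>2 / 2 \<le> energy q t"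
    using \<xi>_nonneg D_nonneg by (simp add: energy_def)
  also have "\<dots> \<le> energy q T"
    using energy_nonincreasing[OF q order_refl t] .
  finally show "norm (extrapolated q t) \<le> sqrt (2 * energy q T)"
    by (intro real_le_rsqrt) simp
qed

lemma position_bounded:
  assumes q: "equilibrium q"
  obtains C where "\<And>t. t \<ge> T \<Longrightarrow> norm (z t - q) \<le> C"
proof -
  obtain M where M: "\<And>t. t \<ge> T \<Longrightarrow> norm (extrapolated q t) \<le> M"
    using extrapolated_bounded[OF q] by blast
  show thesis
  proof (rule weighted_average_bounded[OF \<theta>_pos T_pos])
    show "((\<lambda>t. z t - q) has_vector_derivative z' t) (at t)" if "t \<ge> T" for t
      using velocity[OF that] by (auto intro!: derivative_eq_intros)
    show "norm (z t - q + (\<theta> * t) *\<^sub>R z' t) \<le> M" if "t \<ge> T" for t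
      using M[OF that] by (simp add: extrapolated_def)
  qed (rule that)
qed

lemma bounded_orbit:
  assumes "equilibrium q"
  shows "bounded (z ` {T..})"
proof -
  obtain C where "\<And>t. t \<ge> T \<Longrightarrow> norm (z t - q) \<le> C"
    using position_bounded[OF assms] by blast
  then show ?thesis
    by (intro boundedI[of _ "C + norm q"])
       (auto intro: order_trans[OF norm_triangle_sub[of _ q]])
qed

lemma velocity_bounded:
  assumes q: "equilibrium q"
  obtains V where "\<And>t. t \<ge> T \<Longrightarrow> norm (t *\<^sub>R z' t) \<le> V"
proof -
  obtain M where M: "\<And>t. t \<ge> T \<Longrightarrow> norm (extrapolated q t) \<le> M"
    using extrapolated_bounded[OF q] by blast
  obtain C where C: "\<And>t. t \<ge> T \<Longrightarrow> norm (z t - q) \<le> C"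
    using position_bounded[OF q] by blast
  show thesis
  proof
    fix t assume t: "t \<ge> T"
    have "t *\<^sub>R z' t = (1 / \<theta>) *\<^sub>R (extrapolated q t - (z t - q))"
      using \<theta>_pos by (simp add: extrapolated_def)
    moreover have "norm (extrapolated q t - (z t - q)) \<le> M + C"
      using norm_triangle_ineq4[of "extrapolated q t" "z t - q"] M[OF t] C[OF t] by linarith
    ultimately show "norm (t *\<^sub>R z' t) \<le> 1 / \<theta> * (M + C)"
      using \<theta>_pos by (simp add: divide_right_mono)
  qed
qed

lemma velocity_tendsto_0:
  assumes "equilibrium q"
  shows "(z' \<longlongrightarrow> 0) at_top"
proof -
  obtain V where V: "\<And>t. t \<ge> T \<Longrightarrow> norm (t *\<^sub>R z' t) \<le> V"
    using velocity_bounded[OF assms] by blast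
  have "((\<lambda>t. (1 / t) *\<^sub>R (t *\<^sub>R z' t)) \<longlongrightarrow> 0) at_top"
    by (rule scaled_bounded_tendsto_0[OF _ V]) real_asymp
  then show ?thesis
    by (rule Lim_transform_eventually) (use eventually_T in eventually_elim, simp)
qed

lemma D_tendsto_0:
  assumes q: "equilibrium q"
  shows "((\<lambda>t. D (z t) q) \<longlongrightarrow> 0) at_top"
proof (rule Lim_null_comparison)
  show "\<forall>\<^sub>F t in at_top. norm (D (z t) q) \<le> energy q T / \<theta>\<^sup>2 / t\<^sup>2"
    using eventually_T
  proof eventually_elim
    case (elim t)
    have "\<theta>\<^sup>2 * t\<^sup>2 * D (z t) q \<le> energy q t"
      using \<xi>_nonneg by (simp add: energy_def)
    also have "\<dots> \<le> energy q T"
      using energy_nonincreasing[OF q order_refl] elim by simp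
    finally show ?case
      using \<theta>_pos elim D_nonneg by (simp add: field_simps)
  qed
  show "((\<lambda>t. energy q T / \<theta>\<^sup>2 / t\<^sup>2) \<longlongrightarrow> 0) at_top"
    by (intro tendsto_divide_0[OF tendsto_const] filterlim_at_top_imp_at_infinity) real_asymp
qed

lemma isCont_G: "isCont G p"
  using continuous_gradient continuous_on_eq_continuous_at open_UNIV by blast

lemma isCont_D: "isCont (\<lambda>p. D p q) p"
  using bregman_gderiv[of \<phi> p G q] gradient
  by (auto simp: gderiv_def intro: has_derivative_continuous)

text \<open>
  The gap tends to 0, so it vanishes at every cluster point, and a point at Bregman distance 0 from q has
  the same gradient as q.
\<close>
lemma gradient_tendsto:
  assumes q: "equilibrium q"
  shows "((\<lambda>t. G (z t)) \<longlongrightarrow> G q) at_top"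
proof (rule tendstoI)
  fix e :: real assume e: "e > 0"
  have "\<forall>\<^sub>F t in at_top. z t \<in> {p. dist (G p) (G q) < e}"
  proof (rule eventually_near_cluster_points[OF bounded_orbit[OF q]])
    show "open {p. dist (G p) (G q) < e}"
      using continuous_gradient by (intro open_Collect_less continuous_intros)
    fix s l
    assume s: "filterlim s at_top sequentially" and l: "(\<lambda>n. z (s n)) \<longlonglongrightarrow> l"
    have "(\<lambda>n. D (z (s n)) q) \<longlonglongrightarrow> D l q"
      by (rule isCont_tendsto_compose[OF isCont_D l])
    moreover have "(\<lambda>n. D (z (s n)) q) \<longlonglongrightarrow> 0"
      by (rule filterlim_compose[OF D_tendsto_0[OF q] s])
    ultimately have "D l q = 0"
      by (rule LIMSEQ_unique)
    then have "G l = G q"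
      using bregman_eq_0_imp_gradient_eq[OF convex gradient] by blast
    then show "l \<in> {p. dist (G p) (G q) < e}"
      using e by simp
  qed
  then show "\<forall>\<^sub>F t in at_top. dist (G (z t)) (G q) < e"
    by simp
qed

text \<open>
  In \<theta> t d/dt B (z - q) = B v - B (z - q), the formula for v' replaces B v by - v' / (\<theta> t) and terms that
  vanish in the limit. The correction v / (\<theta> t)^2 absorbs v' / (\<theta> t), which cannot be shown to vanish by itself; the rest
  is the averaging error, the value of r + \<theta> t r' at the corrected function r.
\<close>
definition corrected :: "'a \<Rightarrow> real \<Rightarrow> 'a"
  where "corrected q t = B (z t - q) + (1 / (\<theta> * t)\<^sup>2) *\<^sub>R extrapolated q t"

definition averaging_error :: "'a \<Rightarrow> real \<Rightarrow> 'a"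
  where "averaging_error q t = ((1 - 2 * \<theta>) / (\<theta> * t)\<^sup>2) *\<^sub>R extrapolated q t
    - (\<xi> / (\<theta> * t)) *\<^sub>R z' t - (G (z t) - G q)"

lemma corrected_deriv:
  assumes q: "equilibrium q" and t: "t \<ge> T"
  shows "(corrected q has_vector_derivative
    (1 / (\<theta> * t)) *\<^sub>R (averaging_error q t - corrected q t)) (at t)"
proof -
  let ?m = "extrapolated q t" and ?W = "G (z t) - G q"
  let ?m' = "- (\<xi> *\<^sub>R z' t) - (\<theta> * t) *\<^sub>R (?W + B ?m)"
  have tpos: "t > 0" using t T_pos by simp
  have "((\<lambda>t. 1 / (\<theta> * t)\<^sup>2) has_real_derivative - 2 / (\<theta>\<^sup>2 * t ^ 3)) (at t)"
    using tpos \<theta>_pos by (auto intro!: derivative_eq_intros simp: field_simps power2_eq_square power3_eq_cube)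
  moreover have "((\<lambda>t. B (z t - q)) has_vector_derivative B (z' t)) (at t)"
  proof (rule bounded_linear.has_vector_derivative[OF linear_conv_bounded_linear[THEN iffD1, OF linear_B]])
    show "((\<lambda>t. z t - q) has_vector_derivative z' t) (at t)"
      using velocity[OF t] by (auto intro!: derivative_eq_intros)
  qed
  ultimately have "(corrected q has_vector_derivative
      B (z' t) + ((1 / (\<theta> * t)\<^sup>2) *\<^sub>R ?m' + (- 2 / (\<theta>\<^sup>2 * t ^ 3)) *\<^sub>R ?m)) (at t)"
    unfolding corrected_def
    by (intro has_vector_derivative_add has_vector_derivative_scaleR extrapolated_deriv q t)
  moreover have "B (z' t) + ((1 / (\<theta> * t)\<^sup>2) *\<^sub>R ?m' + (- 2 / (\<theta>\<^sup>2 * t ^ 3)) *\<^sub>R ?m)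
      = (1 / (\<theta> * t)) *\<^sub>R (averaging_error q t - corrected q t)"
  proof -
    have "B ?m = B (z t - q) + (\<theta> * t) *\<^sub>R B (z' t)"
      by (simp add: extrapolated_def B_add B_scale)
    then have Bz: "B (z' t) = (1 / (\<theta> * t)) *\<^sub>R (B ?m - B (z t - q))"
      using tpos \<theta>_pos by simp
    have "(\<theta> * t) *\<^sub>R (B (z' t) + ((1 / (\<theta> * t)\<^sup>2) *\<^sub>R ?m' + (- 2 / (\<theta>\<^sup>2 * t ^ 3)) *\<^sub>R ?m))
      = averaging_error q t - corrected q t"
    proof -
      define c where "c = \<theta> * t"
      have c: "c \<noteq> 0" "c * (1 / c) = 1" "c * (1 / c\<^sup>2) = 1 / c"
        "c * (- 2 / (\<theta>\<^sup>2 * t ^ 3)) = - (2 * \<theta> / c\<^sup>2)"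
        using tpos \<theta>_pos by (auto simp: c_def field_simps power2_eq_square power3_eq_cube)
      have "c *\<^sub>R ((1 / c) *\<^sub>R (b - bz)
            + ((1 / c\<^sup>2) *\<^sub>R (- v - c *\<^sub>R (w + b)) + (- 2 / (\<theta>\<^sup>2 * t ^ 3)) *\<^sub>R m))
          = (1 / c\<^sup>2 - 2 * \<theta> / c\<^sup>2) *\<^sub>R m - (1 / c) *\<^sub>R v - w - (bz + (1 / c\<^sup>2) *\<^sub>R m)"
        for b bz v w m :: 'a
        unfolding scaleR_add_right scaleR_scaleR c(2-4)
        using c(1) by (simp add: scaleR_diff_right scaleR_add_right scaleR_diff_left)
      from this[of "B ?m" "B (z t - q)" "\<xi> *\<^sub>R z' t" ?W ?m] show ?thesis
        unfolding Bz averaging_error_def corrected_def c_def[symmetric]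
        by (simp add: diff_divide_distrib)
    qed
    then have "(1 / (\<theta> * t)) *\<^sub>R ((\<theta> * t) *\<^sub>R
        (B (z' t) + ((1 / (\<theta> * t)\<^sup>2) *\<^sub>R ?m' + (- 2 / (\<theta>\<^sup>2 * t ^ 3)) *\<^sub>R ?m)))
      = (1 / (\<theta> * t)) *\<^sub>R (averaging_error q t - corrected q t)"
      by (rule arg_cong)
    then show ?thesis
      using tpos \<theta>_pos by (simp del: scaleR_add_right scaleR_diff_right)
  qed
  ultimately show ?thesis by simp
qed

lemma skew_part_tendsto_0:
  assumes q: "equilibrium q"
  shows "((\<lambda>t. B (z t - q)) \<longlongrightarrow> 0) at_top"
proof -
  obtain M where M: "\<And>t. t \<ge> T \<Longrightarrow> norm (extrapolated q t) \<le> M"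
    using extrapolated_bounded[OF q] by blast
  have small: "((\<lambda>t. (c / (\<theta> * t)\<^sup>2) *\<^sub>R extrapolated q t) \<longlongrightarrow> 0) at_top" for c
    by (rule scaled_bounded_tendsto_0[OF _ M],
        intro tendsto_divide_0[OF tendsto_const] filterlim_at_top_imp_at_infinity)
      (use \<theta>_pos in real_asymp)
  have "((\<lambda>t. \<xi> / (\<theta> * t)) \<longlongrightarrow> 0) at_top"
    by (intro tendsto_divide_0[OF tendsto_const] filterlim_at_top_imp_at_infinity)
      (use \<theta>_pos in real_asymp)
  then have vel: "((\<lambda>t. (\<xi> / (\<theta> * t)) *\<^sub>R z' t) \<longlongrightarrow> 0 *\<^sub>R 0) at_top"
    by (intro tendsto_scaleR velocity_tendsto_0[OF q])
  have grad: "((\<lambda>t. G (z t) - G q) \<longlongrightarrow> G q - G q) at_top"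
    by (intro tendsto_diff gradient_tendsto[OF q] tendsto_const)
  have err: "(averaging_error q \<longlongrightarrow> 0 - 0 *\<^sub>R 0 - (G q - G q)) at_top"
    unfolding averaging_error_def by (rule tendsto_diff[OF tendsto_diff[OF small vel] grad])
  have "(corrected q \<longlongrightarrow> 0) at_top"
  proof (rule weighted_average_tendsto[OF \<theta>_pos])
    show "\<forall>\<^sub>F t in at_top. (corrected q has_vector_derivative
        (1 / (\<theta> * t)) *\<^sub>R (averaging_error q t - corrected q t)) (at t)"
      using eventually_T by eventually_elim (simp add: corrected_deriv[OF q])
    show "((\<lambda>t. corrected q t + (\<theta> * t) *\<^sub>R
        ((1 / (\<theta> * t)) *\<^sub>R (averaging_error q t - corrected q t))) \<longlongrightarrow> 0) at_top"
    proof (rule Lim_transform_eventually)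
      show "(averaging_error q \<longlongrightarrow> 0) at_top" using err by simp
      show "\<forall>\<^sub>F t in at_top. averaging_error q t = corrected q t + (\<theta> * t) *\<^sub>R
        ((1 / (\<theta> * t)) *\<^sub>R (averaging_error q t - corrected q t))"
        using eventually_T by eventually_elim (use \<theta>_pos in simp)
    qed
  qed
  from tendsto_diff[OF this small[of 1]] show ?thesis
    by (simp add: corrected_def)
qed

lemma cluster_point_equilibrium:
  assumes q: "equilibrium q"
    and s: "filterlim s at_top sequentially" and l: "(\<lambda>n. z (s n)) \<longlonglongrightarrow> l"
  shows "equilibrium l"
proof -
  have "(\<lambda>n. G (z (s n))) \<longlonglongrightarrow> G l"
    by (rule isCont_tendsto_compose[OF isCont_G l])
  moreover have "(\<lambda>n. G (z (s n))) \<longlonglongrightarrow> G q"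
    by (rule filterlim_compose[OF gradient_tendsto[OF q] s])
  ultimately have G: "G l = G q"
    by (rule LIMSEQ_unique)
  have "(\<lambda>n. B (z (s n) - q)) \<longlonglongrightarrow> B (l - q)"
    by (intro bounded_linear.tendsto[OF linear_conv_bounded_linear[THEN iffD1, OF linear_B]]
        tendsto_diff l tendsto_const)
  moreover have "(\<lambda>n. B (z (s n) - q)) \<longlonglongrightarrow> 0"
    by (rule filterlim_compose[OF skew_part_tendsto_0[OF q] s])
  ultimately have "B (l - q) = 0"
    by (rule LIMSEQ_unique)
  then show ?thesis
    using q G by (simp add: equilibrium_def B_diff)
qed

text \<open>
  Two zeros of G + B satisfy (G q1 - G q2) \<bullet> (q1 - q2) = 0 by skewness. The left-hand side is the
  sum of the two Bregman distances, so both vanish; thus the gradients agree and the linear parts of the two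
  distances are the same.
\<close>
lemma D_equilibria_eq:
  assumes q: "equilibrium q1" "equilibrium q2"
  shows "D p q1 = D p q2"
proof -
  have "G q1 = - B q1" "G q2 = - B q2"
    using q by (auto simp: equilibrium_def eq_neg_iff_add_eq_0)
  then have "G q1 - G q2 = - B (q1 - q2)"
    by (simp add: B_diff)
  then have "(G q1 - G q2) \<bullet> (q1 - q2) = 0"
    using skew[of "q1 - q2"] by simp
  then have "D q1 q2 + D q2 q1 = 0"
    by (simp add: bregman_def algebra_simps)
  with D_nonneg[of q1 q2] D_nonneg[of q2 q1] have D0: "D q1 q2 = 0"
    by linarith
  then have "G q1 = G q2"
    by (rule bregman_eq_0_imp_gradient_eq[OF convex gradient])
  with D0 show ?thesis
    by (simp add: bregman_def algebra_simps)
qed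

text \<open>
  In the difference of two energies the gap and all terms quadratic in z and z' cancel, which leaves an
  affine function of z and its derivative.
\<close>
lemma inner_equilibria_diff_tendsto:
  assumes q: "equilibrium q1" "equilibrium q2"
  obtains l where "((\<lambda>t. z t \<bullet> (q2 - q1)) \<longlongrightarrow> l) at_top"
proof -
  obtain l1 l2 where E: "(energy q1 \<longlongrightarrow> l1) at_top" "(energy q2 \<longlongrightarrow> l2) at_top"
    using energy_tendsto q by metis
  define w where "w = (\<lambda>t. ((norm (z t - q1))\<^sup>2 - (norm (z t - q2))\<^sup>2) / 2)"
  have w: "w t = z t \<bullet> (q2 - q1) + ((norm q1)\<^sup>2 - (norm q2)\<^sup>2) / 2" for t
    by (simp add: w_def power2_norm_eq_inner algebra_simps inner_commute diff_divide_distrib add_divide_distrib)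
  have ext: "(norm (extrapolated q1 t))\<^sup>2 / 2 - (norm (extrapolated q2 t))\<^sup>2 / 2
      = w t + \<theta> * t * (z' t \<bullet> (q2 - q1))" for t
    by (simp add: w_def extrapolated_def power2_norm_eq_inner algebra_simps inner_commute
        diff_divide_distrib add_divide_distrib)
  have "energy q1 t - energy q2 t
      = (norm (extrapolated q1 t))\<^sup>2 / 2 - (norm (extrapolated q2 t))\<^sup>2 / 2 + \<xi> * w t" for t
    using D_equilibria_eq[OF q, of "z t"]
    by (simp add: energy_def w_def algebra_simps diff_divide_distrib)
  then have "energy q1 t - energy q2 t = (1 + \<xi>) * w t + \<theta> * t * (z' t \<bullet> (q2 - q1))" for t
    by (simp only: ext distrib_right mult_1 add.commute add.left_commute)
  then have diff: "w t + (\<theta> / (1 + \<xi>) * t) *\<^sub>R (z' t \<bullet> (q2 - q1))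
      = (energy q1 t - energy q2 t) / (1 + \<xi>)" for t
    using \<xi>_nonneg by (simp add: field_simps)
  have "(w \<longlongrightarrow> (l1 - l2) / (1 + \<xi>)) at_top"
  proof (rule weighted_average_tendsto)
    show "\<theta> / (1 + \<xi>) > 0"
      using \<theta>_pos \<xi>_nonneg by simp
    show "\<forall>\<^sub>F t in at_top. (w has_vector_derivative z' t \<bullet> (q2 - q1)) (at t)"
      using eventually_T
    proof eventually_elim
      case (elim t)
      show ?case
        unfolding w
        using bounded_linear.has_vector_derivative[OF bounded_linear_inner_left velocity, of t "q2 - q1"] elim
        by (auto intro!: derivative_eq_intros)
    qed
    show "((\<lambda>t. w t + (\<theta> / (1 + \<xi>) * t) *\<^sub>R (z' t \<bullet> (q2 - q1))) \<longlongrightarrow> (l1 - l2) / (1 + \<xi>)) at_top"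
      unfolding diff using \<xi>_nonneg by (intro tendsto_intros E) auto
  qed
  then have "((\<lambda>t. w t - ((norm q1)\<^sup>2 - (norm q2)\<^sup>2) / 2) \<longlongrightarrow>
      (l1 - l2) / (1 + \<xi>) - ((norm q1)\<^sup>2 - (norm q2)\<^sup>2) / 2) at_top"
    by (intro tendsto_diff tendsto_const)
  then show thesis
    by (intro that) (simp add: w)
qed

theorem converges_to_equilibrium:
  assumes q: "equilibrium q"
  obtains l where "equilibrium l" and "(z \<longlongrightarrow> l) at_top"
proof -
  have "bounded (range (\<lambda>n. z (T + real n)))"
    by (rule bounded_subset[OF bounded_orbit[OF q]]) auto
  then obtain l r where r: "strict_mono r" "((\<lambda>n. z (T + real n)) \<circ> r) \<longlonglongrightarrow> l"
    using bounded_imp_convergent_subsequence by blast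
  define s where "s = (\<lambda>n. T + real (r n))"
  have s: "filterlim s at_top sequentially"
    unfolding s_def
    by (intro filterlim_tendsto_add_at_top[OF tendsto_const]
        filterlim_compose[OF filterlim_real_sequentially filterlim_subseq[OF r(1)]])
  have l: "(\<lambda>n. z (s n)) \<longlonglongrightarrow> l"
    using r(2) by (simp add: s_def o_def)
  have eq: "equilibrium l"
    by (rule cluster_point_equilibrium[OF q s l])
  have "(z \<longlongrightarrow> l) at_top"
  proof (rule tendstoI)
    fix e :: real assume e: "e > 0"
    have "\<forall>\<^sub>F t in at_top. z t \<in> ball l e"
    proof (rule eventually_near_cluster_points[OF bounded_orbit[OF q] open_ball])
      fix s2 l2
      assume s2: "filterlim s2 at_top sequentially" and l2: "(\<lambda>n. z (s2 n)) \<longlonglongrightarrow> l2"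
      have eq2: "equilibrium l2"
        by (rule cluster_point_equilibrium[OF q s2 l2])
      obtain c where c: "((\<lambda>t. z t \<bullet> (l2 - l)) \<longlongrightarrow> c) at_top"
        using inner_equilibria_diff_tendsto[OF eq eq2] .
      have "(\<lambda>n. z (s n) \<bullet> (l2 - l)) \<longlonglongrightarrow> l \<bullet> (l2 - l)"
        by (intro tendsto_inner l tendsto_const)
      then have "l \<bullet> (l2 - l) = c"
        using LIMSEQ_unique[OF _ filterlim_compose[OF c s]] by simp
      moreover have "(\<lambda>n. z (s2 n) \<bullet> (l2 - l)) \<longlonglongrightarrow> l2 \<bullet> (l2 - l)"
        by (intro tendsto_inner l2 tendsto_const)
      then have "l2 \<bullet> (l2 - l) = c"
        using LIMSEQ_unique[OF _ filterlim_compose[OF c s2]] by simp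
      ultimately have "(l2 - l) \<bullet> (l2 - l) = 0"
        by (simp add: inner_diff_left)
      then show "l2 \<in> ball l e"
        using e by simp
    qed
    then show "\<forall>\<^sub>F t in at_top. dist (z t) l < e"
      by (simp add: dist_commute)
  qed
  with eq show thesis by (rule that)
qed

section \<open>Rates for strict parameters\<close>

text \<open>
  The expression is, up to the factor \<theta>^2, the energy minus terms that vanish because z \<rightarrow> q and t z' is
  bounded, so it has a limit. A nonzero limit contradicts the divergence of the
  integral of 1 / t.
\<close>
lemma fast_decay:
  assumes q: "equilibrium q" and lim: "(z \<longlongrightarrow> q) at_top"
    and \<xi>_pos: "\<xi> > 0" and \<theta>_less: "\<theta> < 1/2"
  shows "((\<lambda>t. t\<^sup>2 * (D (z t) q + (norm (z' t))\<^sup>2 / 2)) \<longlongrightarrow> 0) at_top"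
proof -
  define k where "k = (\<lambda>t. D (z t) q + (norm (z' t))\<^sup>2 / 2)"
  obtain l where l: "(energy q \<longlongrightarrow> l) at_top"
    using energy_tendsto[OF q] .
  obtain V where V: "\<And>t. t \<ge> T \<Longrightarrow> norm (t *\<^sub>R z' t) \<le> V"
    using velocity_bounded[OF q] by blast
  have d: "((\<lambda>t. z t - q) \<longlongrightarrow> 0) at_top"
    using lim by (simp add: LIM_zero)
  have "((\<lambda>t. (z t - q) \<bullet> (t *\<^sub>R z' t)) \<longlongrightarrow> 0) at_top"
  proof (rule Lim_null_comparison)
    show "\<forall>\<^sub>F t in at_top. norm ((z t - q) \<bullet> (t *\<^sub>R z' t)) \<le> norm (z t - q) * V"
      using eventually_ge_at_top[of T]
    proof eventually_elim
      case (elim t)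
      show ?case
        using Cauchy_Schwarz_ineq2[of "z t - q" "t *\<^sub>R z' t"] mult_left_mono[OF V[OF elim], of "norm (z t - q)"]
        by (simp del: norm_scaleR inner_scaleR_right)
    qed
    show "((\<lambda>t. norm (z t - q) * V) \<longlongrightarrow> 0) at_top"
      using tendsto_mult_left_zero[OF tendsto_norm_zero[OF d]] .
  qed
  then have "((\<lambda>t. energy q t - (1 + \<xi>) / 2 * (norm (z t - q))\<^sup>2 - \<theta> * ((z t - q) \<bullet> (t *\<^sub>R z' t)))
      \<longlongrightarrow> l - (1 + \<xi>) / 2 * 0\<^sup>2 - \<theta> * 0) at_top"
    by (intro tendsto_intros l tendsto_norm_zero d)
  moreover have "energy q t - (1 + \<xi>) / 2 * (norm (z t - q))\<^sup>2 - \<theta> * ((z t - q) \<bullet> (t *\<^sub>R z' t))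
      = \<theta>\<^sup>2 * (t\<^sup>2 * k t)" for t
    unfolding energy_def k_def extrapolated_def power2_norm_eq_inner
    by (simp add: algebra_simps inner_commute add_divide_distrib diff_divide_distrib) (simp add: power2_eq_square algebra_simps)
  ultimately have lim_k: "((\<lambda>t. \<theta>\<^sup>2 * (t\<^sup>2 * k t)) \<longlongrightarrow> l) at_top"
    by simp
  have "l = 0"
  proof (rule ccontr)
    assume "l \<noteq> 0"
    moreover have "l \<ge> 0"
      using tendsto_lowerbound[OF l] energy_nonneg by simp
    ultimately have "l / 2 < l" "l > 0" by auto
    \<comment> \<open>A rate for which the energy dissipates at least c * s * k s; then c' / s is a lower bound once \<theta>^2 s^2 k s > l / 2.\<close>
    define c where "c = min (\<theta> * (1 - 2 * \<theta>)) (2 * \<xi> * \<theta>)"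
    define c' where "c' = c * (l / 2) / \<theta>\<^sup>2"
    have c: "c > 0" "c' > 0"
      using \<theta>_pos \<theta>_less \<xi>_pos \<open>l > 0\<close> by (auto simp: c_def c'_def)
    obtain t1 where t1: "\<And>t. t \<ge> t1 \<Longrightarrow> \<theta>\<^sup>2 * (t\<^sup>2 * k t) > l / 2 \<and> t \<ge> T \<and> t > 0"
      using eventually_conj[OF order_tendstoD(1)[OF lim_k \<open>l / 2 < l\<close>] eventually_T]
      by (auto simp: eventually_at_top_linorder)
    have decr: "energy q t + c' * ln t \<le> energy q t1 + c' * ln t1" if "t \<ge> t1" for t
    proof (rule DERIV_nonpos_imp_nonincreasing[OF that])
      fix s assume s: "t1 \<le> s" "s \<le> t"
      then have s': "\<theta>\<^sup>2 * (s\<^sup>2 * k s) > l / 2" "s \<ge> T" "s > 0" using t1 by auto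
      obtain e where e: "(energy q has_real_derivative e) (at s)"
        "e \<le> - \<theta> * (1 - 2 * \<theta>) * s * D (z s) q - \<xi> * \<theta> * s * (norm (z' s))\<^sup>2"
        using energy_deriv_le[OF q s'(2)] .
      have "c * D (z s) q \<le> \<theta> * (1 - 2 * \<theta>) * D (z s) q"
        "c * (norm (z' s))\<^sup>2 \<le> 2 * \<xi> * \<theta> * (norm (z' s))\<^sup>2"
        by (auto intro!: mult_right_mono D_nonneg simp: c_def)
      then have "c * k s \<le> \<theta> * (1 - 2 * \<theta>) * D (z s) q + \<xi> * \<theta> * (norm (z' s))\<^sup>2"
        by (simp add: k_def algebra_simps)
      then have "s * (c * k s) \<le> s * (\<theta> * (1 - 2 * \<theta>) * D (z s) q + \<xi> * \<theta> * (norm (z' s))\<^sup>2)"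
        using s' by (intro mult_left_mono) auto
      then have "e \<le> - (s * (c * k s))"
        using e(2) by (simp add: algebra_simps)
      moreover have "c' / s \<le> s * (c * k s)"
      proof -
        have "c * (l / 2) \<le> c * (\<theta>\<^sup>2 * (s\<^sup>2 * k s))"
          using s' c by (intro mult_left_mono) auto
        then show ?thesis
          using s' \<theta>_pos by (simp add: c'_def field_simps power2_eq_square)
      qed
      ultimately have "e + c' / s \<le> 0" by simp
      moreover have "((\<lambda>t. energy q t + c' * ln t) has_real_derivative e + c' / s) (at s)"
        using e(1) s' by (auto intro!: derivative_eq_intros)
      ultimately show "\<exists>y. ((\<lambda>t. energy q t + c' * ln t) has_real_derivative y) (at s) \<and> y \<le> 0"
        by blast
    qed
    have "LIM t at_top. c' * ln t :> at_top"
      using c by real_asymp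
    then have "\<forall>\<^sub>F t in at_top. c' * ln t > energy q t1 + c' * ln t1"
      by (simp add: filterlim_at_top_dense)
    from eventually_happens'[OF _ eventually_conj[OF eventually_ge_at_top[of t1] this]]
    obtain t where "t \<ge> t1" "c' * ln t > energy q t1 + c' * ln t1"
      by auto
    with decr[of t] energy_nonneg[of q t] show False by linarith
  qed
  then have "((\<lambda>t. \<theta>\<^sup>2 * (t\<^sup>2 * k t) / \<theta>\<^sup>2) \<longlongrightarrow> 0 / \<theta>\<^sup>2) at_top"
    using lim_k \<theta>_pos by (intro tendsto_divide tendsto_const) auto
  then show ?thesis
    using \<theta>_pos by (simp add: k_def)
qed

lemma fast_decay_D:
  assumes "equilibrium q" "(z \<longlongrightarrow> q) at_top" "\<xi> > 0" "\<theta> < 1/2"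
  shows "((\<lambda>t. t\<^sup>2 * D (z t) q) \<longlongrightarrow> 0) at_top"
proof (rule Lim_null_comparison)
  show "\<forall>\<^sub>F t in at_top. norm (t\<^sup>2 * D (z t) q) \<le> t\<^sup>2 * (D (z t) q + (norm (z' t))\<^sup>2 / 2)"
  proof (intro always_eventually allI)
    show "norm (t\<^sup>2 * D (z t) q) \<le> t\<^sup>2 * (D (z t) q + (norm (z' t))\<^sup>2 / 2)" for t
      using D_nonneg[of "z t" q] by (simp add: abs_mult mult_left_mono)
  qed
qed (rule fast_decay[OF assms])

lemma fast_decay_velocity:
  assumes "equilibrium q" "(z \<longlongrightarrow> q) at_top" "\<xi> > 0" "\<theta> < 1/2"
  shows "((\<lambda>t. t *\<^sub>R z' t) \<longlongrightarrow> 0) at_top"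
proof -
  have "((\<lambda>t. (norm (t *\<^sub>R z' t))\<^sup>2) \<longlongrightarrow> 0) at_top"
  proof (rule Lim_null_comparison, intro always_eventually allI)
    show "norm ((norm (t *\<^sub>R z' t))\<^sup>2) \<le> 2 * (t\<^sup>2 * (D (z t) q + (norm (z' t))\<^sup>2 / 2))" for t
      using D_nonneg[of "z t" q] by (simp add: power_mult_distrib algebra_simps)
    show "((\<lambda>t. 2 * (t\<^sup>2 * (D (z t) q + (norm (z' t))\<^sup>2 / 2))) \<longlongrightarrow> 0) at_top"
      using tendsto_mult_right_zero[OF fast_decay[OF assms]] .
  qed
  from tendsto_real_sqrt[OF this] show ?thesis
    by (simp add: tendsto_norm_zero_iff del: norm_scaleR scaleR_diff_right)
qed

text \<open>
  Multiplying r by t changes the averaging relation only by a constant: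
  with R = t r, R + (\<theta> / (1 - \<theta>)) t R' = t (r + \<theta> t r') / (1 - \<theta>), and \<theta> < 1 keeps the weight positive.
\<close>
lemma fast_decay_residual:
  assumes q: "equilibrium q" and lim: "(z \<longlongrightarrow> q) at_top"
    and \<xi>_pos: "\<xi> > 0" and \<theta>_less: "\<theta> < 1/2"
    and lip: "L-lipschitz_on UNIV G" and L: "L > 0"
  shows "((\<lambda>t. t *\<^sub>R (G (z t) + B (z t))) \<longlongrightarrow> 0) at_top"
proof -
  obtain M where M: "\<And>t. t \<ge> T \<Longrightarrow> norm (extrapolated q t) \<le> M"
    using extrapolated_bounded[OF q] by blast
  have small: "((\<lambda>t. (c / t) *\<^sub>R extrapolated q t) \<longlongrightarrow> 0) at_top" for c
    by (rule scaled_bounded_tendsto_0[OF _ M],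
        intro tendsto_divide_0[OF tendsto_const] filterlim_at_top_imp_at_infinity) real_asymp
  have "((\<lambda>t. (norm (t *\<^sub>R (G (z t) - G q)))\<^sup>2) \<longlongrightarrow> 0) at_top"
  proof (rule Lim_null_comparison, intro always_eventually allI)
    show "norm ((norm (t *\<^sub>R (G (z t) - G q)))\<^sup>2) \<le> 4 * L * (t\<^sup>2 * D (z t) q)" for t
      using mult_left_mono[OF gradient_sq_le_bregman[OF convex gradient lip L, of "z t" q], of "t\<^sup>2"]
      by (simp add: power_mult_distrib mult.left_commute)
    show "((\<lambda>t. 4 * L * (t\<^sup>2 * D (z t) q)) \<longlongrightarrow> 0) at_top"
      using tendsto_mult_right_zero[OF fast_decay_D[OF q lim \<xi>_pos \<theta>_less]] .
  qed
  from tendsto_real_sqrt[OF this] have W: "((\<lambda>t. t *\<^sub>R (G (z t) - G q)) \<longlongrightarrow> 0) at_top"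
    by (simp add: tendsto_norm_zero_iff del: norm_scaleR scaleR_diff_right)
  have "((\<lambda>t. ((1 - 2 * \<theta>) / \<theta>\<^sup>2 / t) *\<^sub>R extrapolated q t - (\<xi> / \<theta>) *\<^sub>R z' t - t *\<^sub>R (G (z t) - G q))
      \<longlongrightarrow> 0 - (\<xi> / \<theta>) *\<^sub>R 0 - 0) at_top"
    by (intro tendsto_diff small W tendsto_scaleR tendsto_const velocity_tendsto_0[OF q])
  then have err: "((\<lambda>t. t *\<^sub>R averaging_error q t) \<longlongrightarrow> 0 - (\<xi> / \<theta>) *\<^sub>R 0 - 0) at_top"
  proof (rule Lim_transform_eventually)
    show "\<forall>\<^sub>F t in at_top. ((1 - 2 * \<theta>) / \<theta>\<^sup>2 / t) *\<^sub>R extrapolated q t - (\<xi> / \<theta>) *\<^sub>R z' t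
        - t *\<^sub>R (G (z t) - G q) = t *\<^sub>R averaging_error q t"
      using eventually_T
    proof eventually_elim
      case (elim t)
      then have "t * ((1 - 2 * \<theta>) / (\<theta> * t)\<^sup>2) = (1 - 2 * \<theta>) / \<theta>\<^sup>2 / t" "t * (\<xi> / (\<theta> * t)) = \<xi> / \<theta>"
        by (auto simp: power2_eq_square)
      then show ?case
        unfolding averaging_error_def scaleR_diff_right scaleR_scaleR by simp
    qed
  qed
  have "((\<lambda>t. t *\<^sub>R corrected q t) \<longlongrightarrow> 0) at_top"
  proof (rule weighted_average_tendsto)
    show "\<theta> / (1 - \<theta>) > 0"
      using \<theta>_pos \<theta>_less by simp
    show "\<forall>\<^sub>F t in at_top. ((\<lambda>t. t *\<^sub>R corrected q t) has_vector_derivative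
        corrected q t + (1 / \<theta>) *\<^sub>R (averaging_error q t - corrected q t)) (at t)"
      using eventually_T
    proof eventually_elim
      case (elim t)
      then show ?case
        using corrected_deriv[OF q, of t]
        by (auto intro!: derivative_eq_intros)
    qed
    show "((\<lambda>t. t *\<^sub>R corrected q t + (\<theta> / (1 - \<theta>) * t) *\<^sub>R
        (corrected q t + (1 / \<theta>) *\<^sub>R (averaging_error q t - corrected q t))) \<longlongrightarrow> 0) at_top"
    proof (rule Lim_transform_eventually)
      show "((\<lambda>t. (1 / (1 - \<theta>)) *\<^sub>R (t *\<^sub>R averaging_error q t)) \<longlongrightarrow> 0) at_top"
        using tendsto_scaleR[OF tendsto_const err, of "1 / (1 - \<theta>)"] by simp
      have "(1 / (1 - \<theta>)) *\<^sub>R (t *\<^sub>R a) = t *\<^sub>R r + (\<theta> / (1 - \<theta>) * t) *\<^sub>R (r + (1 / \<theta>) *\<^sub>R (a - r))"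
        for a r :: 'a and t
      proof -
        have "(\<theta> / (1 - \<theta>) * t) *\<^sub>R (r + (1 / \<theta>) *\<^sub>R (a - r))
          = (\<theta> / (1 - \<theta>) * t - t / (1 - \<theta>)) *\<^sub>R r + (t / (1 - \<theta>)) *\<^sub>R a"
          using \<theta>_pos by (simp add: algebra_simps)
        also have "\<theta> / (1 - \<theta>) * t - t / (1 - \<theta>) = - t"
          using \<theta>_less by (simp add: diff_divide_distrib[symmetric] divide_eq_eq algebra_simps)
        finally show ?thesis by simp
      qed
      then show "\<forall>\<^sub>F t in at_top. (1 / (1 - \<theta>)) *\<^sub>R (t *\<^sub>R averaging_error q t) =
          t *\<^sub>R corrected q t + (\<theta> / (1 - \<theta>) * t) *\<^sub>R
          (corrected q t + (1 / \<theta>) *\<^sub>R (averaging_error q t - corrected q t))"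
        by (intro always_eventually allI)
    qed
  qed
  then have "((\<lambda>t. t *\<^sub>R (G (z t) - G q) + (t *\<^sub>R corrected q t - (1 / \<theta>\<^sup>2 / t) *\<^sub>R extrapolated q t))
      \<longlongrightarrow> 0 + (0 - 0)) at_top"
    by (intro tendsto_add tendsto_diff W small)
  then have "((\<lambda>t. t *\<^sub>R (G (z t) + B (z t))) \<longlongrightarrow> 0 + (0 - 0)) at_top"
  proof (rule Lim_transform_eventually)
    have Gq: "G q = - B q"
      using q by (simp add: equilibrium_def add_eq_0_iff2)
    show "\<forall>\<^sub>F t in at_top. t *\<^sub>R (G (z t) - G q)
        + (t *\<^sub>R corrected q t - (1 / \<theta>\<^sup>2 / t) *\<^sub>R extrapolated q t) = t *\<^sub>R (G (z t) + B (z t))"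
      using eventually_T
    proof eventually_elim
      case (elim t)
      then have "t * (1 / (\<theta> * t)\<^sup>2) = 1 / \<theta>\<^sup>2 / t"
        by (auto simp: power2_eq_square)
      then have "t *\<^sub>R corrected q t - (1 / \<theta>\<^sup>2 / t) *\<^sub>R extrapolated q t = t *\<^sub>R B (z t - q)"
        unfolding corrected_def scaleR_add_right scaleR_scaleR by simp
      then show ?case
        by (simp add: Gq B_diff scaleR_add_right scaleR_diff_right)
    qed
  qed
  then show ?thesis by simp
qed

end

section \<open>Saddle points of the Lagrangian\<close>

lemma vector_matrix_inner: "(y v* K) \<bullet> x = (K *v x) \<bullet> (y :: real^'m)"
  for K :: "real^'n^'m"
  by (metis dot_lmul_matrix inner_commute)

text \<open>
  Being a saddle point means that xs and ys each minimise a convex function, f or g plus a linear term.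
\<close>
lemma saddle_point_iff_stationary:
  fixes K :: "real^'n^'m"
  assumes f: "convex_on UNIV f" "\<And>p. GDERIV f p :> f' p"
    and g: "convex_on UNIV g" "\<And>p. GDERIV g p :> g' p"
  shows "(xs, ys) \<in> saddle_points (lagrangian f g K) \<longleftrightarrow>
    f' xs + transpose K *v ys = 0 \<and> g' ys - K *v xs = 0"
proof -
  have "(xs, ys) \<in> saddle_points (lagrangian f g K) \<longleftrightarrow>
      (\<forall>p. f xs + (transpose K *v ys) \<bullet> xs \<le> f p + (transpose K *v ys) \<bullet> p) \<and>
      (\<forall>p. g ys + (- (K *v xs)) \<bullet> ys \<le> g p + (- (K *v xs)) \<bullet> p)"
    by (auto simp: saddle_points_def lagrangian_def vector_matrix_inner algebra_simps)
  also have "\<dots> \<longleftrightarrow> f' xs + transpose K *v ys = 0 \<and> g' ys + (- (K *v xs)) = 0"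
    by (simp only: convex_C1_minimiser_iff[where h = f and h' = f', OF f]
        convex_C1_minimiser_iff[where h = g and h' = g', OF g])
  finally show ?thesis by simp
qed

lemma C2_with_derivs_at:
  assumes "C2_with_derivs t0 w w' w''" and "t > t0"
  shows "(w has_vector_derivative w' t) (at t)" "(w' has_vector_derivative w'' t) (at t)"
proof -
  have "at t within {t0..} = at t"
    using \<open>t > t0\<close> by (intro at_within_interior) (simp add: interior_real_atLeast)
  then show "(w has_vector_derivative w' t) (at t)" "(w' has_vector_derivative w'' t) (at t)"
    using assms unfolding C2_with_derivs_def by (metis less_imp_le)+
qed

text \<open>
  At a saddle point the bilinear terms of the gap are the linear part of the Bregman distance of
  f + g, because the gradients there are - K^T ys and K xs.
\<close>
lemma lagrangian_gap_eq_bregman: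
  fixes K :: "real^'n^'m"
  assumes "f' xs + transpose K *v ys = 0" and "g' ys - K *v xs = 0"
  shows "lagrangian f g K x ys - lagrangian f g K xs y
    = bregman (\<lambda>p. f (fst p) + g (snd p)) (\<lambda>p. (f' (fst p), g' (snd p))) (x, y) (xs, ys)"
proof -
  have "f' xs = - (transpose K *v ys)" "g' ys = K *v xs"
    using assms by (auto simp: eq_neg_iff_add_eq_0)
  then show ?thesis
    by (simp add: bregman_def lagrangian_def vector_matrix_inner inner_diff_right algebra_simps)
qed

lemma lipschitz_on_product_map:
  assumes f: "Lf-lipschitz_on UNIV f'" and g: "Lg-lipschitz_on UNIV g'"
  shows "(Lf + Lg)-lipschitz_on UNIV (\<lambda>p. (f' (fst p), g' (snd p)))"
proof (rule lipschitz_onI)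
  have nonneg: "Lf \<ge> 0" "Lg \<ge> 0"
    using f g by (auto simp: lipschitz_on_def)
  then show "0 \<le> Lf + Lg" by simp
  fix p q :: "'a \<times> 'c"
  have "dist (f' (fst p), g' (snd p)) (f' (fst q), g' (snd q))
      \<le> dist (f' (fst p)) (f' (fst q)) + dist (g' (snd p)) (g' (snd q))"
    by (simp add: dist_Pair_Pair sqrt_sum_squares_le_sum)
  also have "\<dots> \<le> Lf * dist (fst p) (fst q) + Lg * dist (snd p) (snd q)"
    using f g by (intro add_mono) (auto intro: lipschitz_onD)
  also have "\<dots> \<le> Lf * dist p q + Lg * dist p q"
    using nonneg by (intro add_mono mult_left_mono dist_fst_le dist_snd_le)
  finally show "dist (f' (fst p), g' (snd p)) (f' (fst q), g' (snd q)) \<le> (Lf + Lg) * dist p q"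
    by (simp add: algebra_simps)
qed

theorem theorem3p3:
  fixes f :: "real^'n \<Rightarrow> real" and f' :: "real^'n \<Rightarrow> real^'n"
    and g :: "real^'m \<Rightarrow> real" and g' :: "real^'m \<Rightarrow> real^'m"
    and K :: "real^'n^'m"
    and \<alpha> \<theta> t0 :: real
    and x x' x'' :: "real \<Rightarrow> real^'n"
    and y y' y'' :: "real \<Rightarrow> real^'m"
  assumes "convex_on UNIV f" and "C1_with_gradient f f'"
    and "convex_on UNIV g" and "C1_with_gradient g g'"
    and "saddle_points (lagrangian f g K) \<noteq> {}"
    and "\<alpha> \<ge> 3" and "\<theta> \<in> {1 / (\<alpha> - 1)..1/2}" and "t0 > 0"
    and "C2_with_derivs t0 x x' x''" and "C2_with_derivs t0 y y' y''"
    and "\<And>t. t \<ge> t0 \<Longrightarrow>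
      x'' t + (\<alpha> / t) *\<^sub>R x' t + f' (x t) + transpose K *v (y t + (\<theta> * t) *\<^sub>R y' t) = 0"
    and "\<And>t. t \<ge> t0 \<Longrightarrow>
      y'' t + (\<alpha> / t) *\<^sub>R y' t + g' (y t) - K *v (x t + (\<theta> * t) *\<^sub>R x' t) = 0"
  shows "\<exists>xs ys. (xs, ys) \<in> saddle_points (lagrangian f g K) \<and>
    ((\<lambda>t. (x t, y t)) \<longlongrightarrow> (xs, ys)) at_top \<and>
    (\<alpha> > 3 \<and> \<theta> \<in> {1 / (\<alpha> - 1)<..<1/2} \<longrightarrow>
      (\<lambda>t. lagrangian f g K (x t) ys - lagrangian f g K xs (y t)) \<in> o[at_top](\<lambda>t. 1 / t\<^sup>2) \<and>
      (\<lambda>t. norm (x' t, y' t)) \<in> o[at_top](\<lambda>t. 1 / t) \<and>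
      (\<forall>Lf>0. \<forall>Lg>0. Lf-lipschitz_on UNIV f' \<and> Lg-lipschitz_on UNIV g' \<longrightarrow>
        (\<lambda>t. norm (f' (x t) + transpose K *v y t, g' (y t) - K *v x t))
          \<in> o[at_top](\<lambda>t. 1 / t)))"
proof -
  define \<phi> where "\<phi> = (\<lambda>p. f (fst p) + g (snd p))"
  define G where "G = (\<lambda>p. (f' (fst p), g' (snd p)))"
  define B where "B = (\<lambda>p. (transpose K *v snd p, - (K *v fst p)))"
  have f: "\<And>p. GDERIV f p :> f' p" "continuous_on UNIV f'"
    and g: "\<And>p. GDERIV g p :> g' p" "continuous_on UNIV g'"
    using assms(2,4) by (auto simp: C1_with_gradient_def)
  have saddle_iff: "(xs, ys) \<in> saddle_points (lagrangian f g K) \<longleftrightarrow>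
      f' xs + transpose K *v ys = 0 \<and> g' ys - K *v xs = 0" for xs ys
    by (rule saddle_point_iff_stationary[OF assms(1) f(1) assms(3) g(1)])
  have \<theta>: "1 / (\<alpha> - 1) \<le> \<theta>" "\<theta> \<le> 1/2" "1 / (\<alpha> - 1) > 0"
    using assms(6,7) by auto
  \<comment> \<open>Starting at t0 + 1 instead of t0 turns the one-sided derivatives into two-sided ones.\<close>
  interpret inertial_flow \<phi> G B "\<lambda>t. (x t, y t)" "\<lambda>t. (x' t, y' t)" "\<lambda>t. (x'' t, y'' t)"
    \<alpha> \<theta> "t0 + 1"
  proof (rule inertial_flow.intro)
    show "convex_on UNIV \<phi>"
    proof (rule convex_onI)
      fix u :: real and p q :: "(real^'n) \<times> (real^'m)"
      assume u: "0 < u" "u < 1"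
      have "f ((1 - u) *\<^sub>R fst p + u *\<^sub>R fst q) \<le> (1 - u) * f (fst p) + u * f (fst q)"
        "g ((1 - u) *\<^sub>R snd p + u *\<^sub>R snd q) \<le> (1 - u) * g (snd p) + u * g (snd q)"
        using u by (auto intro!: convex_onD assms(1,3))
      then show "\<phi> ((1 - u) *\<^sub>R p + u *\<^sub>R q) \<le> (1 - u) * \<phi> p + u * \<phi> q"
        by (simp add: \<phi>_def algebra_simps)
    qed simp
    show "GDERIV \<phi> p :> G p" for p
    proof -
      have "((\<lambda>p. f (fst p)) has_derivative (\<lambda>h. fst h \<bullet> f' (fst p))) (at p)"
        by (rule has_derivative_compose[OF has_derivative_fst[OF has_derivative_ident]
              f(1)[unfolded gderiv_def]])
      moreover have "((\<lambda>p. g (snd p)) has_derivative (\<lambda>h. snd h \<bullet> g' (snd p))) (at p)"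
        by (rule has_derivative_compose[OF has_derivative_snd[OF has_derivative_ident]
              g(1)[unfolded gderiv_def]])
      ultimately show ?thesis
        unfolding gderiv_def \<phi>_def G_def inner_prod_def fst_conv snd_conv
        by (rule has_derivative_add)
    qed
    show "continuous_on UNIV G"
      unfolding G_def
      by (intro continuous_on_Pair continuous_on_compose2[OF f(2)]
          continuous_on_compose2[OF g(2)] continuous_intros) auto
    show "linear B"
      by (rule linearI) (auto simp: B_def matrix_vector_right_distrib scaleR_matrix_vector_assoc
          matrix_vector_mult_scaleR simp del: transpose_matrix_vector)
    show "B p \<bullet> p = 0" for p
      by (simp add: B_def inner_prod_def vector_matrix_inner)
    show "\<theta> > 0"
      using \<theta>(3,1) by (rule less_le_trans)
    show "\<theta> \<le> 1/2" "t0 + 1 > 0"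
      using \<theta> assms(8) by auto
    show "\<theta> * (\<alpha> - 1) \<ge> 1"
      using \<theta>(1) assms(6) by (simp add: divide_le_eq)
  next
    fix t assume t: "t \<ge> t0 + 1"
    show "((\<lambda>t. (x t, y t)) has_vector_derivative (x' t, y' t)) (at t)"
      "((\<lambda>t. (x' t, y' t)) has_vector_derivative (x'' t, y'' t)) (at t)"
      using t C2_with_derivs_at[OF assms(9), of t] C2_with_derivs_at[OF assms(10), of t]
      by (auto intro!: has_vector_derivative_Pair)
    show "(x'' t, y'' t) + (\<alpha> / t) *\<^sub>R (x' t, y' t) + G (x t, y t)
        + B ((x t, y t) + (\<theta> * t) *\<^sub>R (x' t, y' t)) = 0"
      using t assms(11)[of t] assms(12)[of t] by (simp add: G_def B_def zero_prod_def)
  qed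
  have equilibrium_iff: "equilibrium (xs, ys) \<longleftrightarrow> (xs, ys) \<in> saddle_points (lagrangian f g K)" for xs ys
    unfolding saddle_iff equilibrium_def by (simp add: G_def B_def zero_prod_def)
  obtain q0 where "q0 \<in> saddle_points (lagrangian f g K)"
    using assms(5) by blast
  then have "equilibrium q0"
    by (cases q0) (simp only: equilibrium_iff)
  then obtain q where q: "equilibrium q" "((\<lambda>t. (x t, y t)) \<longlongrightarrow> q) at_top"
    using converges_to_equilibrium by blast
  obtain xs ys where "q = (xs, ys)"
    by (cases q)
  with q have eq: "equilibrium (xs, ys)" and lim: "((\<lambda>t. (x t, y t)) \<longlongrightarrow> (xs, ys)) at_top"
    by simp_all
  have saddle: "(xs, ys) \<in> saddle_points (lagrangian f g K)"
    using eq by (simp only: equilibrium_iff)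
  have nonzero: "\<forall>\<^sub>F t :: real in at_top. 1 / t\<^sup>2 \<noteq> 0" "\<forall>\<^sub>F t :: real in at_top. 1 / t \<noteq> 0"
    using eventually_gt_at_top[of "0::real"] by (eventually_elim, simp)+
  have smallo_inverse: "(\<lambda>t. norm (w t)) \<in> o[at_top](\<lambda>t. 1 / t)"
    if "((\<lambda>t. t *\<^sub>R w t) \<longlongrightarrow> 0) at_top" for w :: "real \<Rightarrow> (real^'n) \<times> (real^'m)"
  proof (rule smalloI_tendsto[OF _ nonzero(2)])
    show "((\<lambda>t. norm (w t) / (1 / t)) \<longlongrightarrow> 0) at_top"
      by (rule Lim_transform_eventually[OF tendsto_norm_zero[OF that]])
         (use eventually_gt_at_top[of 0] in eventually_elim, simp)
  qed
  have rates: "(\<lambda>t. lagrangian f g K (x t) ys - lagrangian f g K xs (y t)) \<in> o[at_top](\<lambda>t. 1 / t\<^sup>2) \<and>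
      (\<lambda>t. norm (x' t, y' t)) \<in> o[at_top](\<lambda>t. 1 / t) \<and>
      (\<forall>Lf>0. \<forall>Lg>0. Lf-lipschitz_on UNIV f' \<and> Lg-lipschitz_on UNIV g' \<longrightarrow>
        (\<lambda>t. norm (f' (x t) + transpose K *v y t, g' (y t) - K *v x t))
          \<in> o[at_top](\<lambda>t. 1 / t))"
    if "\<alpha> > 3 \<and> \<theta> \<in> {1 / (\<alpha> - 1)<..<1/2}"
  proof (intro conjI allI impI)
    have \<xi>_pos: "\<xi> > 0" and \<theta>_less: "\<theta> < 1/2"
      using that by (auto simp: \<xi>_def divide_less_eq)
    have gap: "lagrangian f g K (x t) ys - lagrangian f g K xs (y t)
        = bregman \<phi> G (x t, y t) (xs, ys)" for t
      unfolding \<phi>_def G_def using saddle saddle_iff by (intro lagrangian_gap_eq_bregman) auto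
    show "(\<lambda>t. lagrangian f g K (x t) ys - lagrangian f g K xs (y t)) \<in> o[at_top](\<lambda>t. 1 / t\<^sup>2)"
      unfolding gap
      by (rule smalloI_tendsto[OF _ nonzero(1)])
         (use fast_decay_D[OF eq lim \<xi>_pos \<theta>_less] in \<open>simp add: mult.commute\<close>)
    show "(\<lambda>t. norm (x' t, y' t)) \<in> o[at_top](\<lambda>t. 1 / t)"
      by (rule smallo_inverse[OF fast_decay_velocity[OF eq lim \<xi>_pos \<theta>_less]])
    fix Lf Lg :: real
    assume L: "Lf > 0" "Lg > 0" and lip: "Lf-lipschitz_on UNIV f' \<and> Lg-lipschitz_on UNIV g'"
    have "(Lf + Lg)-lipschitz_on UNIV G"
      unfolding G_def using lip by (intro lipschitz_on_product_map) auto
    from fast_decay_residual[OF eq lim \<xi>_pos \<theta>_less this] L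
    have "((\<lambda>t. t *\<^sub>R (G (x t, y t) + B (x t, y t))) \<longlongrightarrow> 0) at_top"
      by simp
    from smallo_inverse[OF this]
    show "(\<lambda>t. norm (f' (x t) + transpose K *v y t, g' (y t) - K *v x t)) \<in> o[at_top](\<lambda>t. 1 / t)"
      by (simp add: G_def B_def)
  qed
  show ?thesis
    by (rule exI[of _ xs], rule exI[of _ ys], rule conjI[OF saddle conjI[OF lim impI]], rule rates)
qed

end
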